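(* Let $X$ be an $L$-algebra. The spectrum $\mathrm{Spec}\,X$ is a sober $T_0$-space such that the set $\mathscr{D}(\mathrm{Spec}\,X)$ of quasicompact open sets is a basis of $\mathrm{Spec}\,X$.
   Context: An $L$-algebra is a set $X$ with a binary operation $(x,y)\mapsto x\cdot y$ and an element $1\in X$ such that for all $x,y,z\in X$: (i) $x\cdot x=x\cdot 1=1$ and $1\cdot x=x$; (ii) $(x\cdot y)\cdot(x\cdot z)=(y\cdot x)\cdot(y\cdot z)$; (iii) $x\cdot y=y\cdot x=1$ implies $x=y$. An ideal of $X$ is a subset $I\subseteq X$ with $1\in I$ such that for all $x,y\in X$: if $x\in I$ and $x\cdot y\in I$, then $y\in I$; if $x\in I$, then $(x\cdot y)\cdot y\in I$; if $x\in I$, then $y\cdot x\in I$ and $y\cdot(x\cdot y)\in I$. $\mathcal{I}(X)$ is the complete lattice of ideals ordered by inclusion (meets are intersections); it is a locale, with operation $I\cdot J=\{x\in X\mid\langle x\rangle\cap I\subseteq J\}$, the greatest ideal $K$ with $K\cap I\subseteq J$, where $\langle x\rangle$ is the ideal generated by $x$. An ideal $P\neq X$ is prime if for every ideal $I$ of $X$ either $I\subseteq P$ or $I\cdot P\subseteq P$ (equivalently, for all ideals $I,J$, $I\cap J\subseteq P$ implies $I\subseteq P$ or $J\subseteq P$). $\mathrm{Spec}\,X$ is the set of prime ideals of $X$, with the topology whose open sets are exactly the sets $U_I:=\{P\in\mathrm{Spec}\,X\mid I\not\subseteq P\}$ for $I\in\mathcal{I}(X)$. Quasicompact means that every open cover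 has a finite subcover (no separation assumed). A topological space is sober if every non-empty closed irreducible set $A$ has a unique generic point $x$, i.e. a unique point $x$ such that $A$ is the closure of $\{x\}$. *)

theory Defs
  imports "HOL-Analysis.Analysis"
begin

section \<open>L-algebras and their ideals\<close>

locale L_algebra =
  fixes X :: "'a set"
    and mult :: "'a \<Rightarrow> 'a \<Rightarrow> 'a"  (infixl \<open>\<cdot>\<close> 70)
    and one :: 'a  (\<open>\<one>\<close>)
  assumes one_closed: "\<one> \<in> X"
    and mult_closed: "\<And>x y. \<lbrakk>x \<in> X; y \<in> X\<rbrakk> \<Longrightarrow> x \<cdot> y \<in> X"
    and mult_self: "\<And>x. x \<in> X \<Longrightarrow> x \<cdot> x = \<one>"
    and mult_one: "\<And>x. x \<in> X \<Longrightarrow> x \<cdot> \<one> = \<one>"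
    and one_mult: "\<And>x. x \<in> X \<Longrightarrow> \<one> \<cdot> x = x"
    and cycloid: "\<And>x y z. \<lbrakk>x \<in> X; y \<in> X; z \<in> X\<rbrakk> \<Longrightarrow>
           (x \<cdot> y) \<cdot> (x \<cdot> z) = (y \<cdot> x) \<cdot> (y \<cdot> z)"
    and mult_antisym: "\<And>x y. \<lbrakk>x \<in> X; y \<in> X; x \<cdot> y = \<one>; y \<cdot> x = \<one>\<rbrakk> \<Longrightarrow> x = y"
begin

definition ideal :: "'a set \<Rightarrow> bool" where
  "ideal I \<longleftrightarrow> I \<subseteq> X \<and> \<one> \<in> I \<and>
     (\<forall>x\<in>X. \<forall>y\<in>X. x \<in> I \<and> x \<cdot> y \<in> I \<longrightarrow> y \<in> I) \<and>
     (\<forall>x\<in>X. \<forall>y\<in>X. x \<in> I \<longrightarrow> (x \<cdot> y) \<cdot> y \<in> I) \<and>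
     (\<forall>x\<in>X. \<forall>y\<in>X. x \<in> I \<longrightarrow> y \<cdot> x \<in> I \<and> y \<cdot> (x \<cdot> y) \<in> I)"

text \<open>The operation on the lattice of ideals, i.e. its Heyting implication.\<close>

definition ideal_imp :: "'a set \<Rightarrow> 'a set \<Rightarrow> 'a set" where
  "ideal_imp I J = {x \<in> X. (ideal hull {x}) \<inter> I \<subseteq> J}"

definition prime_ideal :: "'a set \<Rightarrow> bool" where
  "prime_ideal P \<longleftrightarrow> ideal P \<and> P \<noteq> X \<and>
     (\<forall>I. ideal I \<longrightarrow> I \<subseteq> P \<or> ideal_imp I P \<subseteq> P)"

definition Spec :: "'a set set" where
  "Spec = {P. prime_ideal P}"

definition Spec_open :: "'a set \<Rightarrow> 'a set set" where
  "Spec_open I = {P \<in> Spec. \<not> I \<subseteq> P}"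

text \<open>The sets \<^term>\<open>Spec_open I\<close> are shown below to satisfy \<^const>\<open>istopology\<close>, so
  that \<open>openin_Spec_topology\<close> and \<open>topspace_Spec_topology\<close> hold.\<close>

definition Spec_topology :: "'a set topology" where
  "Spec_topology = topology (\<lambda>U. \<exists>I. ideal I \<and> U = Spec_open I)"

lemma idealI:
  assumes "I \<subseteq> X" "\<one> \<in> I"
    and "\<And>x y. \<lbrakk>x \<in> I; y \<in> X; x \<cdot> y \<in> I\<rbrakk> \<Longrightarrow> y \<in> I"
    and "\<And>x y. \<lbrakk>x \<in> I; y \<in> X\<rbrakk> \<Longrightarrow> (x \<cdot> y) \<cdot> y \<in> I"
    and "\<And>x y. \<lbrakk>x \<in> I; y \<in> X\<rbrakk> \<Longrightarrow> y \<cdot> x \<in> I"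
    and "\<And>x y. \<lbrakk>x \<in> I; y \<in> X\<rbrakk> \<Longrightarrow> y \<cdot> (x \<cdot> y) \<in> I"
  shows "ideal I"
  unfolding ideal_def by (intro conjI ballI impI; (elim conjE)?; rule assms; assumption)

lemma ideal_subset: "ideal I \<Longrightarrow> I \<subseteq> X"
  by (erule ideal_def[THEN iffD1, THEN conjunct1])

lemma ideal_one: "ideal I \<Longrightarrow> \<one> \<in> I"
  by (erule ideal_def[THEN iffD1, THEN conjunct2, THEN conjunct1])

lemma
  assumes "ideal I" "x \<in> I" "y \<in> X"
  shows ideal_mp: "x \<cdot> y \<in> I \<Longrightarrow> y \<in> I"
    and ideal_mult_mult: "(x \<cdot> y) \<cdot> y \<in> I"
    and ideal_mult_left: "y \<cdot> x \<in> I"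
    and ideal_mult_left_mult: "y \<cdot> (x \<cdot> y) \<in> I"
proof -
  have x: "x \<in> X"
    using assms(1,2) ideal_subset by blast
  note I = assms(1)[unfolded ideal_def]
  show "x \<cdot> y \<in> I \<Longrightarrow> y \<in> I" using I x assms(2,3) by blast
  show "(x \<cdot> y) \<cdot> y \<in> I" using I x assms(2,3) by blast
  show "y \<cdot> x \<in> I" using I x assms(2,3) by blast
  show "y \<cdot> (x \<cdot> y) \<in> I" using I x assms(2,3) by blast
qed

lemma ideal_carrier: "ideal X"
  by (rule idealI) (simp_all add: one_closed mult_closed)

lemma ideal_Inter:
  assumes \<I>: "\<And>I. I \<in> \<I> \<Longrightarrow> ideal I" and "\<I> \<noteq> {}"
  shows "ideal (\<Inter>\<I>)"
proof (rule idealI)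
  show "\<Inter>\<I> \<subseteq> X"
    using assms ideal_subset by blast
next
  show "\<one> \<in> \<Inter>\<I>"
    using \<I> ideal_one by auto
next
  fix x y
  assume x: "x \<in> \<Inter>\<I>" and y: "y \<in> X"
  have *: "ideal I" "x \<in> I" if "I \<in> \<I>" for I
    using that x \<I> by auto
  show "y \<in> \<Inter>\<I>" if "x \<cdot> y \<in> \<Inter>\<I>"
    by (rule InterI, rule ideal_mp[OF *(1) *(2) y]) (use that in auto)
  show "(x \<cdot> y) \<cdot> y \<in> \<Inter>\<I>"
    by (rule InterI, rule ideal_mult_mult[OF *(1) *(2) y])
  show "y \<cdot> x \<in> \<Inter>\<I>"
    by (rule InterI, rule ideal_mult_left[OF *(1) *(2) y])
  show "y \<cdot> (x \<cdot> y) \<in> \<Inter>\<I>"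
    by (rule InterI, rule ideal_mult_left_mult[OF *(1) *(2) y])
qed

lemma ideal_Int: "\<lbrakk>ideal I; ideal J\<rbrakk> \<Longrightarrow> ideal (I \<inter> J)"
  using ideal_Inter[of "{I, J}"] by auto

lemma ideal_hull: "S \<subseteq> X \<Longrightarrow> ideal (ideal hull S)"
  unfolding hull_def by (rule ideal_Inter) (use ideal_carrier in auto)

lemma prime_ideal_iff:
  "prime_ideal P \<longleftrightarrow> ideal P \<and> P \<noteq> X \<and>
     (\<forall>I J. ideal I \<and> ideal J \<and> I \<inter> J \<subseteq> P \<longrightarrow> I \<subseteq> P \<or> J \<subseteq> P)"
proof (intro iffI conjI allI impI)
  fix I J
  assume P: "prime_ideal P" and IJ: "ideal I \<and> ideal J \<and> I \<inter> J \<subseteq> P"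
  show "I \<subseteq> P \<or> J \<subseteq> P"
  proof (cases "I \<subseteq> P")
    case False
    then have "ideal_imp I P \<subseteq> P"
      using P IJ by (auto simp: prime_ideal_def)
    moreover have "J \<subseteq> ideal_imp I P"
    proof
      fix x assume "x \<in> J"
      then have "ideal hull {x} \<subseteq> J" and "x \<in> X"
        using IJ by (auto simp: hull_minimal dest: ideal_subset)
      then show "x \<in> ideal_imp I P"
        using IJ by (auto simp: ideal_imp_def)
    qed
    ultimately show ?thesis by blast
  qed simp
next
  assume *: "ideal P \<and> P \<noteq> X \<and>
     (\<forall>I J. ideal I \<and> ideal J \<and> I \<inter> J \<subseteq> P \<longrightarrow> I \<subseteq> P \<or> J \<subseteq> P)"
  have "ideal_imp I P \<subseteq> P" if I: "ideal I" "\<not> I \<subseteq> P" for I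
  proof
    fix x assume x: "x \<in> ideal_imp I P"
    then have "ideal (ideal hull {x})" "(ideal hull {x}) \<inter> I \<subseteq> P"
      using ideal_hull[of "{x}"] by (auto simp: ideal_imp_def)
    then have "ideal hull {x} \<subseteq> P"
      using * I by blast
    then show "x \<in> P"
      using hull_subset[of "{x}" ideal] by blast
  qed
  then show "prime_ideal P"
    using * by (auto simp: prime_ideal_def)
qed (auto simp: prime_ideal_def)

lemma Spec_open_Int:
  assumes "ideal I" "ideal J"
  shows "Spec_open I \<inter> Spec_open J = Spec_open (I \<inter> J)"
  using assms by (auto simp: Spec_open_def Spec_def prime_ideal_iff)

lemma Spec_open_Union:
  assumes "\<And>I. I \<in> \<I> \<Longrightarrow> ideal I"
  shows "\<Union>(Spec_open ` \<I>) = Spec_open (ideal hull \<Union>\<I>)"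
proof -
  have "(ideal hull \<Union>\<I>) \<subseteq> P \<longleftrightarrow> (\<forall>I\<in>\<I>. I \<subseteq> P)" if "P \<in> Spec" for P
  proof
    assume "(ideal hull \<Union>\<I>) \<subseteq> P"
    then show "\<forall>I\<in>\<I>. I \<subseteq> P"
      using hull_subset[of "\<Union>\<I>" ideal] by blast
  next
    assume "\<forall>I\<in>\<I>. I \<subseteq> P"
    then show "(ideal hull \<Union>\<I>) \<subseteq> P"
      using that by (intro hull_minimal) (auto simp: Spec_def prime_ideal_def)
  qed
  then show ?thesis
    by (auto simp: Spec_open_def)
qed

lemma istopology_Spec: "istopology (\<lambda>U. \<exists>I. ideal I \<and> U = Spec_open I)"
  unfolding istopology_def
proof (intro conjI allI impI)
  fix S T
  assume "\<exists>I. ideal I \<and> S = Spec_open I" "\<exists>I. ideal I \<and> T = Spec_open I"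
  then show "\<exists>I. ideal I \<and> S \<inter> T = Spec_open I"
    using Spec_open_Int ideal_Int by metis
next
  fix \<K>
  assume *: "\<forall>K\<in>\<K>. \<exists>I. ideal I \<and> K = Spec_open I"
  define \<I> where "\<I> = {I. ideal I \<and> Spec_open I \<in> \<K>}"
  have "\<K> = Spec_open ` \<I>"
    using * by (auto simp: \<I>_def)
  moreover have "\<Union>\<I> \<subseteq> X"
    by (auto simp: \<I>_def dest: ideal_subset)
  ultimately have "ideal (ideal hull \<Union>\<I>)" "\<Union>\<K> = Spec_open (ideal hull \<Union>\<I>)"
    using Spec_open_Union[of \<I>] ideal_hull[of "\<Union>\<I>"] by (simp_all add: \<I>_def)
  then show "\<exists>I. ideal I \<and> \<Union>\<K> = Spec_open I"
    by blast
qed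

lemma openin_Spec_topology:
  "openin Spec_topology U \<longleftrightarrow> (\<exists>I. ideal I \<and> U = Spec_open I)"
  unfolding Spec_topology_def by (simp add: topology_inverse'[OF istopology_Spec])

lemma topspace_Spec_topology: "topspace Spec_topology = Spec"
proof -
  have "Spec_open X = Spec"
    by (auto simp: Spec_open_def Spec_def prime_ideal_def dest: ideal_subset)
  then have "openin Spec_topology Spec"
    using ideal_carrier openin_Spec_topology by metis
  moreover have "U \<subseteq> Spec" if "openin Spec_topology U" for U
    using that by (auto simp: openin_Spec_topology Spec_open_def)
  ultimately show ?thesis
    by (meson openin_subset openin_topspace subset_antisym)
qed

end


section \<open>Topological notions\<close>

definition irreduciblein :: "'a topology \<Rightarrow> 'a set \<Rightarrow> bool" where
  "irreduciblein T A \<longleftrightarrow> A \<subseteq> topspace T \<and> A \<noteq> {} \<and>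
     (\<forall>B C. closedin T B \<and> closedin T C \<and> A \<subseteq> B \<union> C \<longrightarrow> A \<subseteq> B \<or> A \<subseteq> C)"

definition sober_space :: "'a topology \<Rightarrow> bool" where
  "sober_space T \<longleftrightarrow>
     (\<forall>A. closedin T A \<and> A \<noteq> {} \<and> irreduciblein T A \<longrightarrow>
        (\<exists>!x. x \<in> topspace T \<and> A = T closure_of {x}))"

text \<open>As \<^const>\<open>compactin\<close> involves no separation axiom, it is quasicompactness.\<close>

definition quasicompact_opens :: "'a topology \<Rightarrow> 'a set set" where
  "quasicompact_opens T = {U. openin T U \<and> compactin T U}"

definition basis_of_topology :: "'a topology \<Rightarrow> 'a set set \<Rightarrow> bool" where
  "basis_of_topology T \<B> \<longleftrightarrow>
     (\<forall>B\<in>\<B>. openin T B) \<and> (\<forall>U. openin T U \<longrightarrow> (\<exists>\<C>\<subseteq>\<B>. U = \<Union>\<C>))"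

end

theory Submission
  imports Defs
begin

text \<open>Sobriety and \<open>T\<^sub>0\<close> are formal: the generic point of an irreducible closed
  set is the intersection of its members. For the basis, distributivity of the lattice of ideals is
  needed: it makes an ideal that is maximal among those avoiding \<open>x\<close> prime, so \<open>x\<close> lies in every
  ideal \<open>J\<close> with \<open>U\<^bsub>\<langle>x\<rangle>\<^esub> \<subseteq> U\<^bsub>J\<^esub>\<close>, and \<open>U\<^bsub>\<langle>x\<rangle>\<^esub>\<close>
  is quasicompact because \<open>x\<close> lies in a join of ideals only if it lies in a finite subjoin.

  Both properties of joins rest on a description of the join of a family of ideals with union
  \<open>S\<close>: it consists of the \<open>z\<close> for which \<open>a\<^sub>1 \<cdot> (a\<^sub>2 \<cdot> \<dots> (a\<^sub>n \<cdot> z)) = \<one>\<close> with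
  all \<open>a\<^sub>i \<in> S\<close>. If moreover \<open>z\<close> lies in an ideal \<open>L\<close>, then at each stage \<open>(a \<cdot> z) \<cdot> z\<close> lies
  both in \<open>L\<close> and in the ideal of the family containing \<open>a\<close>, which gives distributivity.\<close>

context L_algebra
begin

section \<open>Joins of ideals through iterated modus ponens\<close>

inductive_set mp_closure :: "'a set \<Rightarrow> 'a set" for S where
  mp_closure_one: "\<one> \<in> mp_closure S"
| mp_closure_step: "\<lbrakk>a \<in> S; z \<in> X; a \<cdot> z \<in> mp_closure S\<rbrakk> \<Longrightarrow> z \<in> mp_closure S"

lemma mp_closure_subset: "mp_closure S \<subseteq> X"
proof
  show "z \<in> X" if "z \<in> mp_closure S" for z
    using that by cases (auto simp: one_closed)
qed

lemma mp_closure_extensive: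
  assumes "S \<subseteq> X"
  shows "S \<subseteq> mp_closure S"
proof
  fix a assume a: "a \<in> S"
  then have "a \<in> X"
    using assms by blast
  with a show "a \<in> mp_closure S"
    using mp_closure_step[of a S a] by (auto simp: mult_self mp_closure_one)
qed

lemma mp_closure_subset_ideal:
  assumes "ideal I" "S \<subseteq> I"
  shows "mp_closure S \<subseteq> I"
proof
  fix z assume "z \<in> mp_closure S"
  then show "z \<in> I"
  proof induction
    case mp_closure_one
    show ?case
      using assms(1) by (rule ideal_one)
  next
    case (mp_closure_step a z)
    then show ?case
      using assms ideal_mp[of I a z] by blast
  qed
qed

text \<open>A derivation has finitely many steps, each drawing its premise from one member of the
  family.\<close>

lemma mp_closure_finite_support:
  assumes "z \<in> mp_closure (\<Union>\<I>)"
  shows "\<exists>\<F>\<subseteq>\<I>. finite \<F> \<and> z \<in> mp_closure (\<Union>\<F>)"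
  using assms
proof induction
  case mp_closure_one
  show ?case
    by (rule exI[of _ "{}"]) (simp add: mp_closure.mp_closure_one)
next
  case (mp_closure_step a z)
  then obtain I \<F> where I: "I \<in> \<I>" "a \<in> I"
    and \<F>: "\<F> \<subseteq> \<I>" "finite \<F>" "a \<cdot> z \<in> mp_closure (\<Union>\<F>)"
    by blast
  have mono: "mp_closure (\<Union>\<F>) \<subseteq> mp_closure (\<Union>(insert I \<F>))"
  proof
    show "w \<in> mp_closure (\<Union>(insert I \<F>))" if "w \<in> mp_closure (\<Union>\<F>)" for w
      using that by induction (auto intro: mp_closure.intros)
  qed
  have "z \<in> mp_closure (\<Union>(insert I \<F>))"
    by (rule mp_closure.mp_closure_step[of a]) (use I \<F> mono mp_closure_step.hyps in auto)
  then show ?case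
    using I \<F> by (intro exI[of _ "insert I \<F>"]) auto
qed

text \<open>Steps of \<open>mp_closure\<close> use premises from the generators only, so general
  modus ponens needs proof too. The union \<open>?S\<close> is already closed under the other three
  ideal operations; the cycloid law carries these through the inductions.\<close>

lemma ideal_mp_closure_Union:
  assumes \<I>: "\<And>I. I \<in> \<I> \<Longrightarrow> ideal I"
  shows "ideal (mp_closure (\<Union>\<I>))"
proof -
  let ?S = "\<Union>\<I>" and ?K = "mp_closure (\<Union>\<I>)"
  have SX: "a \<in> X" if "a \<in> ?S" for a
    using that \<I> ideal_subset by blast
  have S: "(a \<cdot> y) \<cdot> y \<in> ?S" "y \<cdot> a \<in> ?S" "y \<cdot> (a \<cdot> y) \<in> ?S"
    if "a \<in> ?S" "y \<in> X" for a y
    using that \<I> ideal_mult_mult ideal_mult_left ideal_mult_left_mult by blast+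
  have SK: "a \<in> ?K" if "a \<in> ?S" for a
    using that mp_closure_extensive[of ?S] SX by blast
  have left: "y \<cdot> x \<in> ?K" if "x \<in> ?K" "y \<in> X" for x y
    using that
  proof (induction arbitrary: y)
    case mp_closure_one
    then show ?case
      by (simp add: mult_one mp_closure.mp_closure_one)
  next
    case (mp_closure_step a x)
    note X = SX[OF mp_closure_step.hyps(1)] mp_closure_step.hyps(2) mp_closure_step.prems
    \<comment> \<open>By the cycloid law this instance of the hypothesis is
      \<open>(y \<cdot> a) \<cdot> (y \<cdot> x)\<close>; its premise \<open>y \<cdot> a\<close> is
      again in \<open>?S\<close>, so one closure step removes it.\<close>
    have "(a \<cdot> y) \<cdot> (a \<cdot> x) \<in> ?K"
      by (rule mp_closure_step.IH) (use X mult_closed in auto)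
    then have "(y \<cdot> a) \<cdot> (y \<cdot> x) \<in> ?K"
      using X by (simp add: cycloid[of y a x])
    then show ?case
      by (rule mp_closure.mp_closure_step[rotated 2])
        (use X S mp_closure_step.hyps mult_closed in auto)
  qed
  have mp: "y \<in> ?K" if "x \<in> ?K" "y \<in> X" "x \<cdot> y \<in> ?K" for x y
    using that
  proof (induction arbitrary: y)
    case mp_closure_one
    then show ?case
      by (simp add: one_mult)
  next
    case (mp_closure_step a x)
    note X = SX[OF mp_closure_step.hyps(1)] mp_closure_step.hyps(2) mp_closure_step.prems(1)
    \<comment> \<open>Inserting \<open>x \<cdot> a\<close> lets the cycloid law expose the premise
      \<open>a \<cdot> x\<close>, from which the hypothesis derives
      \<open>a \<cdot> y\<close>.\<close>
    have "(x \<cdot> a) \<cdot> (x \<cdot> y) \<in> ?K"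
      using left mp_closure_step.prems X mult_closed by blast
    then have "(a \<cdot> x) \<cdot> (a \<cdot> y) \<in> ?K"
      using X by (simp add: cycloid[of a x y])
    then have "a \<cdot> y \<in> ?K"
      using mp_closure_step.IH X mult_closed by blast
    with mp_closure_step.hyps(1) X(3) show ?case
      by (rule mp_closure.mp_closure_step)
  qed
  \<comment> \<open>Read \<open>u \<cdot> v \<in> ?K\<close> as u \<le> v modulo \<open>?K\<close>;
    chains of such comparisons settle the last two ideal conditions.\<close>
  have trans: "u \<cdot> w \<in> ?K" if "u \<in> X" "v \<in> X" "w \<in> X" "u \<cdot> v \<in> ?K" "v \<cdot> w \<in> ?K" for u v w
  proof (rule mp[OF that(4)])
    show "(u \<cdot> v) \<cdot> (u \<cdot> w) \<in> ?K"
      unfolding cycloid[OF that(1-3)] using that left mult_closed by blast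
  qed (use that mult_closed in auto)
  \<comment> \<open>In both inductions below the induction hypothesis at \<open>a \<cdot> y\<close> is the claim up to replacing
    \<open>x \<cdot> y\<close> by \<open>(x \<cdot> a) \<cdot> (x \<cdot> y)\<close> and \<open>y\<close> by \<open>a \<cdot> y\<close>, which are the same modulo \<open>S\<close>.\<close>
  have mult_mult: "(x \<cdot> y) \<cdot> y \<in> ?K" if "x \<in> ?K" "y \<in> X" for x y
    using that
  proof (induction arbitrary: y)
    case mp_closure_one
    then show ?case
      by (simp add: one_mult mult_self mp_closure.mp_closure_one)
  next
    case (mp_closure_step a x)
    note a = mp_closure_step.hyps(1)
    note X = SX[OF a] mp_closure_step.hyps(2) mp_closure_step.prems
    define p q r where "p = (x \<cdot> a) \<cdot> (x \<cdot> y)" and "q = a \<cdot> y" and "r = x \<cdot> y"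
    have pqr: "p \<in> X" "q \<in> X" "r \<in> X"
      using X mult_closed by (auto simp: p_def q_def r_def)
    have "((a \<cdot> x) \<cdot> (a \<cdot> y)) \<cdot> (a \<cdot> y) \<in> ?K"
      using mp_closure_step.IH X mult_closed by blast
    then have "p \<cdot> q \<in> ?K"
      using X by (simp add: cycloid[of a x y] p_def q_def)
    moreover have "r \<cdot> p \<in> ?K"
      using S(3)[of "x \<cdot> a" r] S(2)[OF a X(2)] SK pqr by (simp add: p_def r_def)
    ultimately have "r \<cdot> q \<in> ?K"
      using trans pqr by blast
    moreover have "q \<cdot> y \<in> ?K"
      using S(1)[OF a X(3)] SK by (simp add: q_def)
    ultimately have "r \<cdot> y \<in> ?K"
      using trans pqr X by blast
    then show ?case
      by (simp add: r_def)
  qed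
  have left_mult: "y \<cdot> (x \<cdot> y) \<in> ?K" if "x \<in> ?K" "y \<in> X" for x y
    using that
  proof (induction arbitrary: y)
    case mp_closure_one
    then show ?case
      by (simp add: one_mult mult_self mp_closure.mp_closure_one)
  next
    case (mp_closure_step a x)
    note a = mp_closure_step.hyps(1)
    note X = SX[OF a] mp_closure_step.hyps(2) mp_closure_step.prems
    define p q r where "p = (x \<cdot> a) \<cdot> (x \<cdot> y)" and "q = a \<cdot> y" and "r = x \<cdot> y"
    have pqr: "p \<in> X" "q \<in> X" "r \<in> X"
      using X mult_closed by (auto simp: p_def q_def r_def)
    have "(a \<cdot> y) \<cdot> ((a \<cdot> x) \<cdot> (a \<cdot> y)) \<in> ?K"
      using mp_closure_step.IH X mult_closed by blast
    then have "q \<cdot> p \<in> ?K"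
      using X by (simp add: cycloid[of a x y] p_def q_def)
    moreover have "p \<cdot> r \<in> ?K"
      using S(1)[of "x \<cdot> a" r] S(2)[OF a X(2)] SK pqr by (simp add: p_def r_def)
    ultimately have "q \<cdot> r \<in> ?K"
      using trans pqr by blast
    moreover have "y \<cdot> q \<in> ?K"
      using S(3)[OF a X(3)] SK by (simp add: q_def)
    ultimately have "y \<cdot> r \<in> ?K"
      using trans pqr X by blast
    then show ?case
      by (simp add: r_def)
  qed
  show ?thesis
    by (rule idealI; rule mp_closure_subset mp_closure_one mp mult_mult left left_mult; assumption)
qed

lemma ideal_hull_Union:
  assumes "\<And>I. I \<in> \<I> \<Longrightarrow> ideal I"
  shows "ideal hull \<Union>\<I> = mp_closure (\<Union>\<I>)"
proof (rule hull_unique)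
  show "\<Union>\<I> \<subseteq> mp_closure (\<Union>\<I>)"
    by (rule mp_closure_extensive) (use assms ideal_subset in blast)
  show "ideal (mp_closure (\<Union>\<I>))"
    using assms by (rule ideal_mp_closure_Union)
qed (rule mp_closure_subset_ideal)

lemma ideal_hull_Union_finite:
  assumes "\<And>I. I \<in> \<I> \<Longrightarrow> ideal I" "x \<in> ideal hull \<Union>\<I>"
  obtains \<F> where "\<F> \<subseteq> \<I>" "finite \<F>" "x \<in> ideal hull \<Union>\<F>"
proof -
  have "x \<in> mp_closure (\<Union>\<I>)"
    using assms ideal_hull_Union[of \<I>] by simp
  then obtain \<F> where \<F>: "\<F> \<subseteq> \<I>" "finite \<F>" "x \<in> mp_closure (\<Union>\<F>)"
    using mp_closure_finite_support by blast
  then have "ideal I" if "I \<in> \<F>" for I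
    using that assms(1) by blast
  then have "x \<in> ideal hull \<Union>\<F>"
    using \<F>(3) ideal_hull_Union[of \<F>] by simp
  with \<F> show thesis
    using that by blast
qed

section \<open>Distributivity of the lattice of ideals\<close>

text \<open>With \<open>M\<close> the join of all \<open>L \<inter> I\<close> this is the
  distributive law; a free \<open>M\<close> lets a candidate prime be used directly.\<close>

lemma ideal_Int_hull_Union_subset:
  assumes \<I>: "\<And>I. I \<in> \<I> \<Longrightarrow> ideal I" and "ideal L" "ideal M"
    and M: "\<And>I. I \<in> \<I> \<Longrightarrow> L \<inter> I \<subseteq> M"
  shows "L \<inter> (ideal hull \<Union>\<I>) \<subseteq> M"
proof -
  have "z \<in> M" if "z \<in> mp_closure (\<Union>\<I>)" "z \<in> L" for z
    using that
  proof induction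
    case mp_closure_one
    then show ?case
      using \<open>ideal M\<close> ideal_one by blast
  next
    case (mp_closure_step a z)
    then obtain I where I: "I \<in> \<I>" "a \<in> I" "ideal I"
      using \<I> by blast
    have X: "a \<in> X" "a \<cdot> z \<in> X"
      using I ideal_subset mult_closed mp_closure_step.hyps by blast+
    \<comment> \<open>\<open>L\<close> absorbs left multiplication, so \<open>a \<cdot> z\<close>
      stays in \<open>L\<close> and the hypothesis applies to it.\<close>
    have "a \<cdot> z \<in> M"
      using mp_closure_step \<open>ideal L\<close> X ideal_mult_left by blast
    moreover have "(a \<cdot> z) \<cdot> z \<in> L \<inter> I"
      using mp_closure_step I \<open>ideal L\<close> X ideal_mult_left ideal_mult_mult by blast
    ultimately show ?case
      using ideal_mp[OF \<open>ideal M\<close>] M[OF I(1)] mp_closure_step.hyps by blast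
  qed
  then show ?thesis
    using ideal_hull_Union[of \<I>] \<I> by (simp add: subset_iff)
qed

lemma ideal_Int_hull_Un_subset:
  assumes "ideal I" "ideal J" "ideal L" "ideal M" "L \<inter> I \<subseteq> M" "L \<inter> J \<subseteq> M"
  shows "L \<inter> (ideal hull (I \<union> J)) \<subseteq> M"
  using ideal_Int_hull_Union_subset[of "{I, J}" L M] assms by auto

section \<open>Prime ideals from Zorn's lemma\<close>

lemma ideal_Union_chain:
  assumes C: "subset.chain \<A> C" "C \<noteq> {}" and \<A>: "\<And>I. I \<in> \<A> \<Longrightarrow> ideal I"
  shows "ideal (\<Union>C)"
proof -
  have id: "ideal I" if "I \<in> C" for I
    using that C \<A> by (auto simp: subset_chain_def)
  show ?thesis
  proof (rule idealI)
    show "\<Union>C \<subseteq> X" "\<one> \<in> \<Union>C"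
      using id ideal_subset ideal_one C(2) by blast+
  next
    fix x y assume "x \<in> \<Union>C" and y: "y \<in> X"
    then obtain I where I: "I \<in> C" "x \<in> I"
      by blast
    show "(x \<cdot> y) \<cdot> y \<in> \<Union>C" "y \<cdot> x \<in> \<Union>C" "y \<cdot> (x \<cdot> y) \<in> \<Union>C"
      using I id y ideal_mult_mult ideal_mult_left ideal_mult_left_mult by blast+
    assume "x \<cdot> y \<in> \<Union>C"
    then obtain J where J: "J \<in> C" "x \<cdot> y \<in> J"
      by blast
    \<comment> \<open>Only modus ponens has two premises; the larger of the two chain members
      contains both.\<close>
    then have "I \<subseteq> J \<or> J \<subseteq> I"
      using C I by (auto simp: subset_chain_def)
    then show "y \<in> \<Union>C"
      using I J id y ideal_mp by blast
  qed
qed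

lemma prime_ideal_separation:
  assumes "ideal J" "x \<in> X" "x \<notin> J"
  obtains P where "prime_ideal P" "J \<subseteq> P" "x \<notin> P"
proof -
  define \<A> where "\<A> = {I. ideal I \<and> J \<subseteq> I \<and> x \<notin> I}"
  have "\<exists>P\<in>\<A>. \<forall>I\<in>\<A>. P \<subseteq> I \<longrightarrow> I = P"
  proof (rule subset_Zorn_nonempty)
    show "\<A> \<noteq> {}"
      using assms by (auto simp: \<A>_def)
  next
    fix C assume C: "C \<noteq> {}" "subset.chain \<A> C"
    have "ideal (\<Union>C)"
      by (rule ideal_Union_chain[OF C(2,1)]) (simp add: \<A>_def)
    then show "\<Union>C \<in> \<A>"
      using C by (auto simp: \<A>_def subset_chain_def)
  qed
  then obtain P where P: "ideal P" "J \<subseteq> P" "x \<notin> P"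
    and max: "\<And>I. \<lbrakk>ideal I; J \<subseteq> I; x \<notin> I; P \<subseteq> I\<rbrakk> \<Longrightarrow> I = P"
    by (auto simp: \<A>_def)
  \<comment> \<open>By maximality, enlarging \<open>P\<close> by an ideal not inside it captures
    \<open>x\<close>.\<close>
  have join: "ideal (ideal hull (P \<union> I))" "x \<in> ideal hull (P \<union> I)"
    if "ideal I" "\<not> I \<subseteq> P" for I
  proof -
    show id: "ideal (ideal hull (P \<union> I))"
      by (rule ideal_hull) (use P that ideal_subset in blast)
    have "P \<union> I \<subseteq> ideal hull (P \<union> I)"
      by (rule hull_subset)
    then show "x \<in> ideal hull (P \<union> I)"
      using max[OF id] P that by blast
  qed
  have "I \<subseteq> P \<or> K \<subseteq> P" if "ideal I" "ideal K" "I \<inter> K \<subseteq> P" for I K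
  proof (rule ccontr)
    assume "\<not> (I \<subseteq> P \<or> K \<subseteq> P)"
    then have n: "\<not> I \<subseteq> P" "\<not> K \<subseteq> P"
      by auto
    let ?L = "ideal hull (P \<union> K)"
    \<comment> \<open>Distributivity, used once for each join, puts the meet of the joins of
      \<open>P\<close> with \<open>I\<close> and with \<open>K\<close> inside \<open>P\<close>,
      although \<open>x\<close> lies in both joins.\<close>
    have "I \<inter> ?L \<subseteq> P"
      by (rule ideal_Int_hull_Un_subset) (use that P in auto)
    then have "?L \<inter> (ideal hull (P \<union> I)) \<subseteq> P"
      using join(1)[of K] that n P by (intro ideal_Int_hull_Un_subset) auto
    then show False
      using join(2) that n P by blast
  qed
  then have "prime_ideal P"
    using P assms by (auto simp: prime_ideal_iff)
  then show thesis
    using that P by blast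
qed

section \<open>A basis of quasicompact open sets\<close>

lemma Spec_open_subset_iff:
  assumes "x \<in> X" "ideal J"
  shows "Spec_open (ideal hull {x}) \<subseteq> Spec_open J \<longleftrightarrow> x \<in> J"
proof
  assume *: "Spec_open (ideal hull {x}) \<subseteq> Spec_open J"
  show "x \<in> J"
  proof (rule ccontr)
    assume "x \<notin> J"
    then obtain P where P: "prime_ideal P" "J \<subseteq> P" "x \<notin> P"
      using prime_ideal_separation assms by blast
    then have "P \<in> Spec_open (ideal hull {x})"
      using hull_subset[of "{x}" ideal] by (auto simp: Spec_open_def Spec_def)
    with * P show False
      by (auto simp: Spec_open_def)
  qed
next
  assume "x \<in> J"
  then have "ideal hull {x} \<subseteq> J"
    using assms by (intro hull_minimal) auto
  then show "Spec_open (ideal hull {x}) \<subseteq> Spec_open J"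
    by (auto simp: Spec_open_def)
qed

lemma compactin_Spec_open_principal:
  assumes x: "x \<in> X"
  shows "compactin Spec_topology (Spec_open (ideal hull {x}))"
  unfolding compactin_def
proof (intro conjI allI impI)
  show "Spec_open (ideal hull {x}) \<subseteq> topspace Spec_topology"
    by (auto simp: topspace_Spec_topology Spec_open_def)
next
  fix \<U> assume \<U>: "Ball \<U> (openin Spec_topology) \<and> Spec_open (ideal hull {x}) \<subseteq> \<Union>\<U>"
  \<comment> \<open>The ideals behind the cover: \<open>Spec_open\<close> turns their join into the
    union of the cover, so covering means that \<open>x\<close> lies in this join.\<close>
  define \<I> where "\<I> = {I. ideal I \<and> Spec_open I \<in> \<U>}"
  have id: "ideal I" if "I \<in> \<I>" for I
    using that by (simp add: \<I>_def)
  have hull: "ideal (ideal hull \<Union>\<J>)" if "\<J> \<subseteq> \<I>" for \<J>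
    by (rule ideal_hull) (use that id ideal_subset in blast)
  have "\<U> = Spec_open ` \<I>"
    using \<U> by (auto simp: \<I>_def openin_Spec_topology)
  then have "Spec_open (ideal hull {x}) \<subseteq> Spec_open (ideal hull \<Union>\<I>)"
    using \<U> Spec_open_Union[of \<I>] id by simp
  then have "x \<in> ideal hull \<Union>\<I>"
    using Spec_open_subset_iff x hull by blast
  then obtain \<F> where \<F>: "\<F> \<subseteq> \<I>" "finite \<F>" "x \<in> ideal hull \<Union>\<F>"
    using ideal_hull_Union_finite id by metis
  then have "Spec_open (ideal hull {x}) \<subseteq> Spec_open (ideal hull \<Union>\<F>)"
    using Spec_open_subset_iff x hull by blast
  also have "\<dots> = \<Union>(Spec_open ` \<F>)"
    using Spec_open_Union[of \<F>] \<F> id by blast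
  finally show "\<exists>\<V>. finite \<V> \<and> \<V> \<subseteq> \<U> \<and> Spec_open (ideal hull {x}) \<subseteq> \<Union>\<V>"
    using \<F> \<open>\<U> = Spec_open ` \<I>\<close> by (intro exI[of _ "Spec_open ` \<F>"]) auto
qed

lemma Spec_open_eq_Union_principal:
  assumes "ideal I"
  shows "Spec_open I = (\<Union>x\<in>I. Spec_open (ideal hull {x}))"
proof -
  have "ideal hull {x} \<subseteq> P \<longleftrightarrow> x \<in> P" if "P \<in> Spec" for x P
    using that hull_subset[of "{x}" ideal] hull_minimal[of "{x}" P ideal]
    by (auto simp: Spec_def prime_ideal_def)
  then show ?thesis
    by (auto simp: Spec_open_def)
qed

lemma basis_Spec_topology: "basis_of_topology Spec_topology (quasicompact_opens Spec_topology)"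
  unfolding basis_of_topology_def
proof (intro conjI allI impI ballI)
  show "openin Spec_topology B" if "B \<in> quasicompact_opens Spec_topology" for B
    using that by (simp add: quasicompact_opens_def)
next
  fix U assume "openin Spec_topology U"
  then obtain I where I: "ideal I" "U = Spec_open I"
    by (auto simp: openin_Spec_topology)
  have "Spec_open (ideal hull {x}) \<in> quasicompact_opens Spec_topology" if "x \<in> I" for x
    using that I ideal_subset[of I] ideal_hull[of "{x}"]
    by (auto simp: quasicompact_opens_def openin_Spec_topology compactin_Spec_open_principal)
  then show "\<exists>\<C>\<subseteq>quasicompact_opens Spec_topology. U = \<Union>\<C>"
    using I Spec_open_eq_Union_principal[of I]
    by (intro exI[of _ "(\<lambda>x. Spec_open (ideal hull {x})) ` I"]) auto
qed

section \<open>Closed sets, separation and generic points\<close>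

lemma closedin_Spec_topology:
  "closedin Spec_topology A \<longleftrightarrow> (\<exists>I. ideal I \<and> A = {P \<in> Spec. I \<subseteq> P})"
proof -
  have "A = {P \<in> Spec. I \<subseteq> P} \<longleftrightarrow> A \<subseteq> Spec \<and> Spec - A = Spec_open I" for I
    by (auto simp: Spec_open_def)
  then show ?thesis
    by (auto simp: closedin_def topspace_Spec_topology openin_Spec_topology)
qed

text \<open>Closed sets are upward closed in \<open>Spec\<close>, so a generic point of a closed set
  is its least member.\<close>

lemma closure_of_Spec_singleton:
  assumes "P \<in> Spec"
  shows "Spec_topology closure_of {P} = {Q \<in> Spec. P \<subseteq> Q}"
proof (rule closure_of_unique)
  show "closedin Spec_topology {Q \<in> Spec. P \<subseteq> Q}"
    using assms by (auto simp: closedin_Spec_topology Spec_def prime_ideal_def)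
next
  fix A assume "{P} \<subseteq> A" "closedin Spec_topology A"
  then obtain I where "A = {Q \<in> Spec. I \<subseteq> Q}" "I \<subseteq> P"
    by (auto simp: closedin_Spec_topology)
  then show "{Q \<in> Spec. P \<subseteq> Q} \<subseteq> A"
    by blast
qed (use assms in simp)

lemma t0_space_Spec_topology: "t0_space Spec_topology"
  unfolding t0_space_def topspace_Spec_topology
proof (intro ballI impI)
  fix P Q assume PQ: "P \<in> Spec" "Q \<in> Spec" "P \<noteq> Q"
  then have "openin Spec_topology (Spec_open P)" "openin Spec_topology (Spec_open Q)"
    by (auto simp: openin_Spec_topology Spec_def prime_ideal_def)
  \<comment> \<open>If neither set separated the points, \<open>P \<subseteq> Q\<close> and
    \<open>Q \<subseteq> P\<close> would both hold.\<close>
  moreover have "(P \<notin> Spec_open P \<and> Q \<in> Spec_open P) \<or> (Q \<notin> Spec_open Q \<and> P \<in> Spec_open Q)"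
    using PQ by (auto simp: Spec_open_def)
  ultimately show "\<exists>U. openin Spec_topology U \<and> (P \<notin> U \<longleftrightarrow> Q \<in> U)"
    by blast
qed

text \<open>If \<open>I \<inter> J\<close> lies in \<open>\<Inter>A\<close>, each prime in
  \<open>A\<close> contains \<open>I\<close> or \<open>J\<close>; so two closed sets cover
  \<open>A\<close>, and irreducibility selects one.\<close>

lemma prime_ideal_Inter_irreducible:
  assumes "irreduciblein Spec_topology A"
  shows "prime_ideal (\<Inter>A)"
proof -
  have A: "A \<subseteq> Spec" "A \<noteq> {}"
    using assms by (auto simp: irreduciblein_def topspace_Spec_topology)
  then have prime: "prime_ideal Q" if "Q \<in> A" for Q
    using that by (auto simp: Spec_def)
  then have "ideal (\<Inter>A)"
    using A by (intro ideal_Inter) (auto simp: prime_ideal_def)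
  moreover have "\<Inter>A \<noteq> X"
  proof
    assume "\<Inter>A = X"
    then have "X \<subseteq> Q" if "Q \<in> A" for Q
      using that by blast
    moreover obtain Q where "Q \<in> A"
      using A(2) by blast
    ultimately show False
      using prime[of Q] ideal_subset[of Q] by (auto simp: prime_ideal_def)
  qed
  moreover have "I \<subseteq> \<Inter>A \<or> J \<subseteq> \<Inter>A" if IJ: "ideal I" "ideal J" "I \<inter> J \<subseteq> \<Inter>A" for I J
  proof -
    have "I \<subseteq> Q \<or> J \<subseteq> Q" if "Q \<in> A" for Q
      using prime[OF that] IJ that by (auto simp: prime_ideal_iff le_Inf_iff)
    then have "A \<subseteq> {Q \<in> Spec. I \<subseteq> Q} \<union> {Q \<in> Spec. J \<subseteq> Q}"
      using A by blast
    moreover have "closedin Spec_topology {Q \<in> Spec. I \<subseteq> Q}"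
      "closedin Spec_topology {Q \<in> Spec. J \<subseteq> Q}"
      using IJ by (auto simp: closedin_Spec_topology)
    ultimately have "A \<subseteq> {Q \<in> Spec. I \<subseteq> Q} \<or> A \<subseteq> {Q \<in> Spec. J \<subseteq> Q}"
      using assms unfolding irreduciblein_def by blast
    then show ?thesis
      by blast
  qed
  ultimately show ?thesis
    by (simp add: prime_ideal_iff)
qed

lemma sober_space_Spec_topology: "sober_space Spec_topology"
  unfolding sober_space_def topspace_Spec_topology
proof (intro allI impI, elim conjE)
  fix A assume "closedin Spec_topology A" and irr: "irreduciblein Spec_topology A"
  then obtain I where I: "A = {P \<in> Spec. I \<subseteq> P}"
    by (auto simp: closedin_Spec_topology)
  have P: "\<Inter>A \<in> Spec"
    using prime_ideal_Inter_irreducible[OF irr] by (simp add: Spec_def)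
  show "\<exists>!P. P \<in> Spec \<and> A = Spec_topology closure_of {P}"
  proof (rule ex1I[of _ "\<Inter>A"])
    \<comment> \<open>\<open>I \<subseteq> \<Inter>A\<close>, hence a prime above
      \<open>\<Inter>A\<close> contains \<open>I\<close> and belongs to \<open>A\<close>.\<close>
    have "A = {Q \<in> Spec. \<Inter>A \<subseteq> Q}"
      using I by blast
    then show "\<Inter>A \<in> Spec \<and> A = Spec_topology closure_of {\<Inter>A}"
      using P closure_of_Spec_singleton by simp
  next
    fix Q assume "Q \<in> Spec \<and> A = Spec_topology closure_of {Q}"
    then have "Q \<in> Spec" "A = {R \<in> Spec. Q \<subseteq> R}"
      using closure_of_Spec_singleton by auto
    then show "Q = \<Inter>A"
      by blast
  qed
qed

end

theorem proposition3:
  fixes X :: "'a set" and mult :: "'a \<Rightarrow> 'a \<Rightarrow> 'a" and one :: 'a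
  assumes "L_algebra X mult one"
  shows "sober_space (L_algebra.Spec_topology X mult one) \<and>
         t0_space (L_algebra.Spec_topology X mult one) \<and>
         basis_of_topology (L_algebra.Spec_topology X mult one)
           (quasicompact_opens (L_algebra.Spec_topology X mult one))"
  using L_algebra.sober_space_Spec_topology[OF assms] L_algebra.t0_space_Spec_topology[OF assms]
    L_algebra.basis_Spec_topology[OF assms] by blast

end
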